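(* Let $\varphi$ be an $H$-flow on a manifold $M$. For every $\varphi$-invariant probability measure $\mu$ on $M$, one has $$h_{\mathrm{Kat}}(\mu)\le h_{\mathrm{Gur}}(\varphi).$$
   Context: **Setting.** $(M,g)$ is a complete connected (not necessarily compact) Riemannian manifold with associated distance $d$; $B(x,r)$ is the open ball. **$H$-flow.** An $H$-flow is a $C^1$ flow $(\varphi_t)_{t\in\mathbb R}$ on a complete Riemannian manifold such that: (1) there is a constant $lip(\varphi)$ with $d(\varphi_\tau(x),\varphi_\tau(y))\le lip(\varphi)\,d(x,y)$ for all $x,y\in M$, $\tau\in[-1,1]$; (2) there exist $0<a\le b$ such that for every $x\in M$ there is $\rho>0$ with $a|t|\le d(x,\varphi_t(x))\le b|t|$ for all $t\in[-\rho,\rho]$; (3) (transitivity) for all nonempty open $U,V\subset M$ and every $T>0$ there is $t\ge T$ with $\varphi_t(U)\cap V\ne\emptyset$; (4) (finite exact shadowing) for every compact $K\subset M$, $\delta>0$ and integer $N\ge1$ there is $\eta>0$ such that, for all $x_1,\dots,x_N\in K$ and $t_1,\dots,t_N\ge 0$ with $d(\varphi_{t_i}(x_i),x_{i+1})<\eta$ for $1\le i\le N-1$, there is $y\in M$ with $d(\varphi_{s+\sum_{j=1}^{i-1}t_j}(y),\varphi_s(x_i))<\delta$ for all $1\le i\le N$ and $0\le s\le t_i$; (5) (closing lemma) for every $\epsilon>0$ and $x\in M$ there exist $\delta>0$ and $T_{\min}>0$ such that for every $y\in B(x,\epsilon)$ and $t\ge T_{\min}$ with $d(\varphi_t(y),y)\le\delta$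 there exist $z\in B(y,\epsilon)$ and $\tau\in[t-\epsilon,t+\epsilon]$ with $\varphi_\tau(z)=z$ and $d(\varphi_s(z),\varphi_s(y))\le\epsilon$ for all $0\le s\le t$; (6) (expansivity) for every $\nu>0$ there is $\epsilon>0$ such that, for all $x,y\in M$, if there is a continuous map $s:\mathbb R\to\mathbb R$ with $s(0)=0$ and $d(\varphi_t(x),\varphi_{s(t)}(y))\le\epsilon$ for all $t\in\mathbb R$, then $y=\varphi_\tau(x)$ for some $\tau\in[-\nu,\nu]$. **Gurevic entropy.** A periodic orbit $\gamma$ is a pair $(\{\varphi_t(x):t\in\mathbb R\},T)$ with $T>0$, $\varphi_T(x)=x$; its period is $\ell(\gamma)=T$ (so multiples of an orbit count as distinct periodic orbits). For $K\subset M$ compact, $\mathcal P_K(T_0,T_1)$ is the set of periodic orbits $\gamma$ with $\ell(\gamma)\in[T_0,T_1]$ and $\gamma\cap K\neq\emptyset$. $h_{\mathrm{Gur}}(\varphi)=\limsup_{L\to\infty}\frac1L\log\#\mathcal P_K(L,L+\sigma)$ for any compact $K$ with nonempty interior and any $\sigma>0$ (it does not depend on $K,\sigma$). **Katok entropy.** Dynamical balls: $B(x,\epsilon,T)=\{y:\ d(\varphi_t(x),\varphi_t(y))<\epsilon\ \forall t\in[0,T]\}$. For $\alpha\in(0,1)$, a finite set $E$ is $(T,\epsilon,\alpha,\mu)$-spanning if $\mu(\bigcup_{x\in E}B(x,\epsilon,T))\ge\alpha$; $M(T,\epsilon,\alpha,\mu)$ is the minimal cardinality of such a set, and $h_{\mathrm{Kat}}(\mu)=\inf_{\alpha>0}\sup_{\epsilon>0}\limsup_{T\to\infty}\frac1T\log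 M(T,\epsilon,\alpha,\mu)$. *)

theory Defs
  imports "HOL-Analysis.Analysis" "HOL-Probability.Probability_Measure"
begin

text \<open>
  Conventions. The manifold \<open>M\<close> is a type \<open>'a\<close> of class \<open>metric_space\<close>, modelled on a Euclidean
  space \<open>'e\<close>. The locale \<open>riemannian_manifold\<close> requires that \<open>dist\<close> is the distance
  of the Riemannian metric, and charts are homeomorphisms for the topology of \<open>dist\<close>. Since
  the Riemannian distance of a connected manifold is a metric inducing the manifold topology,
  every connected Riemannian manifold arises in this way.
\<close>

section \<open>Riemannian manifolds\<close>

text \<open>Class \<open>C\<^sup>k\<close>; only meaningful on open sets \<open>S\<close>.\<close>

primrec Ck_on :: "nat \<Rightarrow> 'e::euclidean_space set \<Rightarrow> ('e \<Rightarrow> 'f::real_normed_vector) \<Rightarrow> bool" where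
  "Ck_on 0 S f \<longleftrightarrow> continuous_on S f"
| "Ck_on (Suc k) S f \<longleftrightarrow> (\<forall>x\<in>S. f differentiable (at x)) \<and>
     (\<forall>v. Ck_on k S (\<lambda>x. frechet_derivative f (at x) v))"

definition smooth_on :: "'e::euclidean_space set \<Rightarrow> ('e \<Rightarrow> 'f::real_normed_vector) \<Rightarrow> bool" where
  "smooth_on S f \<longleftrightarrow> (\<forall>k. Ck_on k S f)"

text \<open>A chart \<open>(U, c)\<close> consists of its domain and the coordinate map, used only on \<open>U\<close>.\<close>

type_synonym ('a, 'e) chart = "'a set \<times> ('a \<Rightarrow> 'e)"

abbreviation chart_dom :: "('a, 'e) chart \<Rightarrow> 'a set" where
  "chart_dom k \<equiv> fst k"

abbreviation chart_map :: "('a, 'e) chart \<Rightarrow> 'a \<Rightarrow> 'e" where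
  "chart_map k \<equiv> snd k"

abbreviation chart_image :: "('a, 'e) chart \<Rightarrow> 'e set" where
  "chart_image k \<equiv> chart_map k ` chart_dom k"

abbreviation chart_inv :: "('a, 'e) chart \<Rightarrow> 'e \<Rightarrow> 'a" where
  "chart_inv k \<equiv> inv_into (chart_dom k) (chart_map k)"

abbreviation transition :: "('a, 'e) chart \<Rightarrow> ('a, 'e) chart \<Rightarrow> 'e \<Rightarrow> 'e" where
  "transition k l \<equiv> \<lambda>u. chart_map l (chart_inv k u)"

text \<open>
  A Riemannian metric is given by its coordinate expressions: \<open>G k u\<close> is the inner product that
  the metric induces on \<open>'e\<close>, identified by the chart \<open>k\<close> with the tangent space at the point
  with coordinates \<open>u\<close>.
\<close>

type_synonym ('a, 'e) local_metric = "('a, 'e) chart \<Rightarrow> 'e \<Rightarrow> 'e \<Rightarrow> 'e \<Rightarrow> real"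

definition C1_curve_on ::
  "('a::topological_space, 'e::euclidean_space) chart set \<Rightarrow> real \<Rightarrow> real \<Rightarrow> (real \<Rightarrow> 'a) \<Rightarrow> bool"
where
  "C1_curve_on A a b p \<longleftrightarrow> continuous_on {a..b} p \<and>
     (\<forall>k\<in>A. \<exists>D. continuous_on {t\<in>{a..b}. p t \<in> chart_dom k} D \<and>
        (\<forall>t\<in>{a..b}. p t \<in> chart_dom k \<longrightarrow>
           ((\<lambda>s. chart_map k (p s)) has_vector_derivative D t) (at t within {a..b})))"

definition piecewise_C1_curve ::
  "('a::topological_space, 'e::euclidean_space) chart set \<Rightarrow> (real \<Rightarrow> 'a) \<Rightarrow> bool" where
  "piecewise_C1_curve A p \<longleftrightarrow>
     (\<exists>(n::nat) (r::nat \<Rightarrow> real). r 0 = 0 \<and> r n = 1 \<and>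
        (\<forall>i<n. r i < r (Suc i) \<and> C1_curve_on A (r i) (r (Suc i)) p))"

text \<open>
  The speed does not depend on the chart selected. At the finitely many break points, where the
  derivative need not exist, its value is irrelevant for the length.
\<close>

definition curve_speed ::
  "('a, 'e::euclidean_space) chart set \<Rightarrow> ('a, 'e) local_metric \<Rightarrow> (real \<Rightarrow> 'a) \<Rightarrow> real \<Rightarrow> real" where
  "curve_speed A G p t =
     (let k = (SOME k. k \<in> A \<and> p t \<in> chart_dom k);
          v = vector_derivative (\<lambda>s. chart_map k (p s)) (at t)
      in sqrt (G k (chart_map k (p t)) v v))"

definition curve_length ::
  "('a, 'e::euclidean_space) chart set \<Rightarrow> ('a, 'e) local_metric \<Rightarrow> (real \<Rightarrow> 'a) \<Rightarrow> real" where
  "curve_length A G p = integral {0..1} (curve_speed A G p)"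

definition riemannian_distance ::
  "('a::topological_space, 'e::euclidean_space) chart set \<Rightarrow> ('a, 'e) local_metric \<Rightarrow>
     'a \<Rightarrow> 'a \<Rightarrow> real" where
  "riemannian_distance A G x y =
     Inf {curve_length A G p | p. piecewise_C1_curve A p \<and> p 0 = x \<and> p 1 = y}"

locale riemannian_manifold =
  fixes A :: "('a::metric_space, 'e::euclidean_space) chart set"
    and G :: "('a, 'e) local_metric"
  assumes chart_open: "k \<in> A \<Longrightarrow> open (chart_dom k)"
    and chart_image_open: "k \<in> A \<Longrightarrow> open (chart_image k)"
    and chart_homeomorphism:
      "k \<in> A \<Longrightarrow> homeomorphism (chart_dom k) (chart_image k) (chart_map k) (chart_inv k)"
    and charts_cover: "(\<Union>k\<in>A. chart_dom k) = UNIV"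
    and transition_smooth:
      "k \<in> A \<Longrightarrow> l \<in> A \<Longrightarrow>
         smooth_on (chart_map k ` (chart_dom k \<inter> chart_dom l)) (transition k l)"
    and metric_bilinear: "k \<in> A \<Longrightarrow> u \<in> chart_image k \<Longrightarrow> bilinear (G k u)"
    and metric_sym: "k \<in> A \<Longrightarrow> u \<in> chart_image k \<Longrightarrow> G k u v w = G k u w v"
    and metric_pos: "k \<in> A \<Longrightarrow> u \<in> chart_image k \<Longrightarrow> v \<noteq> 0 \<Longrightarrow> 0 < G k u v v"
    and metric_smooth: "k \<in> A \<Longrightarrow> smooth_on (chart_image k) (\<lambda>u. G k u v w)"
    and metric_compat:
      "k \<in> A \<Longrightarrow> l \<in> A \<Longrightarrow> u \<in> chart_map k ` (chart_dom k \<inter> chart_dom l) \<Longrightarrow>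
         G k u v w = G l (transition k l u)
           (frechet_derivative (transition k l) (at u) v)
           (frechet_derivative (transition k l) (at u) w)"
    and dist_riemannian: "dist x y = riemannian_distance A G x y"

locale complete_connected_riemannian_manifold = riemannian_manifold A G
  for A :: "('a::metric_space, 'e::euclidean_space) chart set" and G +
  assumes complete_M: "complete (UNIV :: 'a set)"
    and connected_M: "connected (UNIV :: 'a set)"

section \<open>H-flows\<close>

text \<open>A flow is \<open>C\<^sup>1\<close> if it is \<open>C\<^sup>1\<close> jointly in time and space, in all charts.\<close>

locale C1_flow =
  fixes A :: "('a::metric_space, 'e::euclidean_space) chart set"
    and \<phi> :: "real \<Rightarrow> 'a \<Rightarrow> 'a"
  assumes flow_0: "\<phi> 0 x = x"
    and flow_add: "\<phi> (s + t) x = \<phi> s (\<phi> t x)"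
    and flow_continuous: "continuous_on UNIV (\<lambda>(t, x). \<phi> t x)"
    and flow_C1:
      "k \<in> A \<Longrightarrow> l \<in> A \<Longrightarrow>
         Ck_on 1 {(t, u). u \<in> chart_image k \<and> \<phi> t (chart_inv k u) \<in> chart_dom l}
           (\<lambda>(t, u). chart_map l (\<phi> t (chart_inv k u)))"

locale H_flow = complete_connected_riemannian_manifold A G + C1_flow A \<phi>
  for A :: "('a::metric_space, 'e::euclidean_space) chart set" and G and \<phi> +
  assumes lipschitz:
      "\<exists>lip. \<forall>x y. \<forall>\<tau>\<in>{-1..1}. dist (\<phi> \<tau> x) (\<phi> \<tau> y) \<le> lip * dist x y"
    and local_speed:
      "\<exists>a b. 0 < a \<and> a \<le> b \<and> (\<forall>x. \<exists>\<rho>>0. \<forall>t\<in>{-\<rho>..\<rho>}.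
         a * \<bar>t\<bar> \<le> dist x (\<phi> t x) \<and> dist x (\<phi> t x) \<le> b * \<bar>t\<bar>)"
    and transitivity:
      "\<And>U V T. open U \<Longrightarrow> open V \<Longrightarrow> U \<noteq> {} \<Longrightarrow> V \<noteq> {} \<Longrightarrow> 0 < T \<Longrightarrow>
         \<exists>t\<ge>T. \<phi> t ` U \<inter> V \<noteq> {}"
    and finite_exact_shadowing:
      "\<And>K \<delta> N. compact K \<Longrightarrow> 0 < \<delta> \<Longrightarrow> 1 \<le> N \<Longrightarrow>
         \<exists>\<eta>>0. \<forall>(x :: nat \<Rightarrow> 'a) (t :: nat \<Rightarrow> real).
           (\<forall>i\<in>{1..N}. x i \<in> K \<and> 0 \<le> t i) \<and>
           (\<forall>i\<in>{1..<N}. dist (\<phi> (t i) (x i)) (x (i + 1)) < \<eta>) \<longrightarrow>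
           (\<exists>y. \<forall>i\<in>{1..N}. \<forall>s\<in>{0..t i}.
              dist (\<phi> (s + (\<Sum>j\<in>{1..<i}. t j)) y) (\<phi> s (x i)) < \<delta>)"
    and closing_lemma:
      "\<And>\<epsilon> x. 0 < \<epsilon> \<Longrightarrow>
         \<exists>\<delta>>0. \<exists>Tmin>0. \<forall>y\<in>ball x \<epsilon>. \<forall>t\<ge>Tmin. dist (\<phi> t y) y \<le> \<delta> \<longrightarrow>
           (\<exists>z\<in>ball y \<epsilon>. \<exists>\<tau>\<in>{t - \<epsilon>..t + \<epsilon>}. \<phi> \<tau> z = z \<and>
              (\<forall>s\<in>{0..t}. dist (\<phi> s z) (\<phi> s y) \<le> \<epsilon>))"
    and expansivity:
      "\<And>\<nu>. 0 < \<nu> \<Longrightarrow>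
         \<exists>\<epsilon>>0. \<forall>x y.
           (\<exists>s :: real \<Rightarrow> real. continuous_on UNIV s \<and> s 0 = 0 \<and>
              (\<forall>t. dist (\<phi> t x) (\<phi> (s t) y) \<le> \<epsilon>)) \<longrightarrow>
           (\<exists>\<tau>\<in>{-\<nu>..\<nu>}. y = \<phi> \<tau> x)"

section \<open>Entropies\<close>

text \<open>
  Cardinalities are extended naturals and entropies extended reals, with \<open>log 0 = -\<infinity>\<close>
  and \<open>log \<infinity> = \<infinity>\<close>, so that no junk value (such as \<open>card\<close> of an infinite set) enters.
\<close>

definition ecard :: "'b set \<Rightarrow> enat" where
  "ecard S = (if finite S then enat (card S) else \<infinity>)"

definition log_enat :: "enat \<Rightarrow> ereal" where
  "log_enat m = (case m of enat n \<Rightarrow> if n = 0 then -\<infinity> else ereal (ln (real n)) | \<infinity> \<Rightarrow> \<infinity>)"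

definition periodic_orbits :: "(real \<Rightarrow> 'a \<Rightarrow> 'a) \<Rightarrow> ('a set \<times> real) set" where
  "periodic_orbits \<phi> = {(range (\<lambda>t. \<phi> t x), T) | x T. 0 < T \<and> \<phi> T x = x}"

definition periodic_orbits_meeting ::
  "(real \<Rightarrow> 'a \<Rightarrow> 'a) \<Rightarrow> 'a set \<Rightarrow> real \<Rightarrow> real \<Rightarrow> ('a set \<times> real) set" where
  "periodic_orbits_meeting \<phi> K T0 T1 =
     {(\<gamma>, T) \<in> periodic_orbits \<phi>. T \<in> {T0..T1} \<and> \<gamma> \<inter> K \<noteq> {}}"

definition gurevic_entropy :: "(real \<Rightarrow> 'a \<Rightarrow> 'a) \<Rightarrow> 'a set \<Rightarrow> real \<Rightarrow> ereal" where
  "gurevic_entropy \<phi> K \<sigma> =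
     Limsup at_top (\<lambda>L::real.
       log_enat (ecard (periodic_orbits_meeting \<phi> K L (L + \<sigma>))) / ereal L)"

definition invariant_probability ::
  "(real \<Rightarrow> 'a \<Rightarrow> 'a::topological_space) \<Rightarrow> 'a measure \<Rightarrow> bool" where
  "invariant_probability \<phi> \<mu> \<longleftrightarrow>
     prob_space \<mu> \<and> sets \<mu> = sets borel \<and> (\<forall>t. distr \<mu> borel (\<phi> t) = \<mu>)"

definition dynamical_ball :: "(real \<Rightarrow> 'a \<Rightarrow> 'a::metric_space) \<Rightarrow> 'a \<Rightarrow> real \<Rightarrow> real \<Rightarrow> 'a set" where
  "dynamical_ball \<phi> x \<epsilon> T = {y. \<forall>t\<in>{0..T}. dist (\<phi> t x) (\<phi> t y) < \<epsilon>}"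

definition spanning ::
  "(real \<Rightarrow> 'a \<Rightarrow> 'a::metric_space) \<Rightarrow> real \<Rightarrow> real \<Rightarrow> real \<Rightarrow> 'a measure \<Rightarrow> 'a set \<Rightarrow> bool" where
  "spanning \<phi> T \<epsilon> \<alpha> \<mu> E \<longleftrightarrow>
     finite E \<and> \<alpha> \<le> measure \<mu> (\<Union>x\<in>E. dynamical_ball \<phi> x \<epsilon> T)"

definition min_spanning ::
  "(real \<Rightarrow> 'a \<Rightarrow> 'a::metric_space) \<Rightarrow> real \<Rightarrow> real \<Rightarrow> real \<Rightarrow> 'a measure \<Rightarrow> enat" where
  "min_spanning \<phi> T \<epsilon> \<alpha> \<mu> = (INF E\<in>{E. spanning \<phi> T \<epsilon> \<alpha> \<mu> E}. enat (card E))"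

definition katok_entropy :: "(real \<Rightarrow> 'a \<Rightarrow> 'a::metric_space) \<Rightarrow> 'a measure \<Rightarrow> ereal" where
  "katok_entropy \<phi> \<mu> =
     (INF \<alpha>\<in>{0<..<1}. SUP \<epsilon>\<in>{0<..}.
        Limsup at_top (\<lambda>T::real. log_enat (min_spanning \<phi> T \<epsilon> \<alpha> \<mu>) / ereal T))"

end

theory Submission
  imports Defs "HOL-Real_Asymp.Real_Asymp"
begin

text \<open>
  Fix a scale \<open>\<epsilon> > 0\<close>. The theorem holds because, for all large \<open>T\<close> and all points outside a set of measure
  less than \<open>1/2\<close>, the orbit segment of length \<open>T\<close> is shadowed up to \<open>\<epsilon>\<close> by a periodic orbit of
  period \<open>T + O(1)\<close> that meets \<open>K\<close>. Since the infimum over \<open>\<alpha>\<close> in the Katok entropy is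
  at most its value at \<open>\<alpha> = 1/2\<close>, it suffices to span a set of measure at least \<open>1/2\<close>.

  The space is separable (\<open>countable_dense\<close>): by transitivity the orbits through a small chart
  neighbourhood are dense. With local compactness this yields an open set \<open>S\<close> inside
  a compact set with \<open>\<mu> S > 3/4\<close> (\<open>measure_exhaustion\<close>), so by invariance the set \<open>Q\<close> of points of
  \<open>S\<close> that lie in \<open>S\<close> at time \<open>T\<close> has measure at least \<open>1/2\<close>. The orbit segment of a point \<open>x\<close> of \<open>Q\<close>
  is followed by a segment from near \<open>\<phi> T x\<close> into the interior of \<open>K\<close> and by another one from
  there back to near \<open>x\<close>. By compactness these have bounded lengths (\<open>uniform_transit\<close>), so that finite
  exact shadowing and then the closing lemma provide the periodic orbit (\<open>periodic_shadowing\<close>).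

  One periodic orbit cannot shadow many separated points: as the flow has bounded speed
  (\<open>speed_bound\<close>), points of the same periodic orbit whose time parameters are close stay close
  for all times. Hence an \<open>\<epsilon>\<close>-separated subset of \<open>Q\<close> has at most \<open>O(T)\<close> times as many
  elements as there are periodic orbits with periods in a window \<open>[T - 1, T + R]\<close>
  (\<open>card_separated_le\<close>), and if there are finitely many of these, a separated subset of maximal
  cardinality exists and spans \<open>Q\<close>. Finally the window is
  covered by finitely many windows of length \<open>\<sigma>\<close>, and neither their number nor the factor \<open>O(T)\<close>
  affects the exponential growth rate.
\<close>

section \<open>Flows, dynamical balls and invariant measures\<close>

context C1_flow
begin

lemma flow_cont_pair:
  assumes "continuous_on S f" and "continuous_on S g"
  shows "continuous_on S (\<lambda>z. \<phi> (f z) (g z))"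
  using continuous_on_compose2[OF flow_continuous, of S "\<lambda>z. (f z, g z)"] assms
  by (auto intro!: continuous_intros simp: case_prod_unfold)

lemma flow_uminus [simp]: "\<phi> (-t) (\<phi> t x) = x" "\<phi> t (\<phi> (-t) x) = x"
  using flow_add[of "-t" t x] flow_add[of t "-t" x] by (simp_all add: flow_0)

text \<open>
  The ball is defined by a strict inequality at all times of a compact interval, so the tube lemma
  applies; in particular dynamical balls are Borel sets.
\<close>
lemma open_dynamical_ball: "open (dynamical_ball \<phi> x \<epsilon> T)"
proof (subst open_subopen, intro ballI)
  fix y assume y: "y \<in> dynamical_ball \<phi> x \<epsilon> T"
  let ?W = "{p. dist (\<phi> (snd p) x) (\<phi> (snd p) (fst p)) < \<epsilon>}"
  have op: "open ?W"
    by (intro open_Collect_less continuous_intros flow_cont_pair)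
  have sub: "{y} \<times> {0..T} \<subseteq> ?W"
    using y by (auto simp: dynamical_ball_def)
  obtain V where V: "y \<in> V" "open V" "V \<times> {0..T} \<subseteq> ?W"
    using Elementary_Topology.tube_lemma[OF compact_Icc op sub] by blast
  have "V \<subseteq> dynamical_ball \<phi> x \<epsilon> T"
  proof
    fix z assume "z \<in> V"
    then have "(z, t) \<in> ?W" if "t \<in> {0..T}" for t
      using V(3) that by blast
    then show "z \<in> dynamical_ball \<phi> x \<epsilon> T"
      unfolding dynamical_ball_def by simp
  qed
  with V show "\<exists>V. open V \<and> y \<in> V \<and> V \<subseteq> dynamical_ball \<phi> x \<epsilon> T"
    by blast
qed

lemma invariant_probability_measure:
  assumes "invariant_probability \<phi> \<mu>" and "open S"
  shows "measure \<mu> (\<phi> t -` S) = measure \<mu> S"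
proof -
  have sets: "sets \<mu> = sets borel" and distr: "distr \<mu> borel (\<phi> t) = \<mu>"
    using assms(1) by (auto simp: invariant_probability_def)
  have "\<phi> t \<in> borel \<rightarrow>\<^sub>M borel"
    by (intro borel_measurable_continuous_onI flow_cont_pair continuous_intros)
  then have "\<phi> t \<in> \<mu> \<rightarrow>\<^sub>M borel"
    using measurable_cong_sets[OF sets refl] by blast
  then have "measure (distr \<mu> borel (\<phi> t)) S = measure \<mu> (\<phi> t -` S \<inter> space \<mu>)"
    using assms(2) by (intro measure_distr) auto
  moreover have "space \<mu> = UNIV"
    using sets_eq_imp_space_eq[OF sets] by simp
  ultimately show ?thesis
    using distr by simp
qed

end

section \<open>Local compactness, separability and tightness\<close>

context riemannian_manifold
begin

lemma locally_compact:
  fixes x :: 'a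
  obtains W C where "open W" "x \<in> W" "compact C" "W \<subseteq> C"
proof -
  obtain k where k: "k \<in> A" "x \<in> chart_dom k"
    using charts_cover by blast
  let ?c = "chart_map k" and ?g = "chart_inv k"
  have hom: "homeomorphism (chart_dom k) (chart_image k) ?c ?g"
    using chart_homeomorphism[OF k(1)] .
  have "?c x \<in> chart_image k" using k by blast
  then obtain e where e: "e > 0" "cball (?c x) e \<subseteq> chart_image k"
    using chart_image_open[OF k(1)] open_contains_cball by blast
  let ?W = "chart_dom k \<inter> ?c -` ball (?c x) e"
  have "open ?W"
    using continuous_open_preimage[OF homeomorphism_cont1[OF hom] chart_open[OF k(1)]] by blast
  moreover have "x \<in> ?W" using k e by auto
  moreover have "compact (?g ` cball (?c x) e)"
    by (intro compact_continuous_image continuous_on_subset[OF homeomorphism_cont2[OF hom] e(2)])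
      auto
  moreover have "?W \<subseteq> ?g ` cball (?c x) e"
  proof
    fix w assume w: "w \<in> ?W"
    then have "?g (?c w) = w" using homeomorphism_apply1[OF hom] by auto
    then show "w \<in> ?g ` cball (?c x) e" using w
      by (metis Int_iff ball_subset_cball image_eqI subsetD vimageE)
  qed
  ultimately show thesis by (rule that)
qed

end

context H_flow
begin

text \<open>
  The local upper bound on the speed is global with the same constant: the set of times in \<open>[0, t]\<close> at
  which the bound holds is compact, and the local bound extends it beyond a maximum smaller than \<open>t\<close>.
\<close>
lemma speed_bound:
  obtains b where "0 < b" "\<And>x t. dist x (\<phi> t x) \<le> b * \<bar>t\<bar>"
proof -
  obtain a b where ab: "0 < a" "a \<le> b"
    and loc: "\<And>x. \<exists>\<rho>>0. \<forall>t\<in>{-\<rho>..\<rho>}. a * \<bar>t\<bar> \<le> dist x (\<phi> t x) \<and> dist x (\<phi> t x) \<le> b * \<bar>t\<bar>"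
    using local_speed by blast
  have pos: "dist x (\<phi> t x) \<le> b * t" if "0 \<le> t" for x t
  proof -
    let ?S = "{0..t} \<inter> {s. dist x (\<phi> s x) \<le> b * s}"
    have "compact ?S"
      by (intro compact_Int_closed compact_Icc closed_Collect_le continuous_intros flow_cont_pair)
    moreover have "0 \<in> ?S" using that by (simp add: flow_0)
    ultimately obtain m where m: "m \<in> ?S" "\<And>s. s \<in> ?S \<Longrightarrow> s \<le> m"
      using compact_attains_sup[of ?S] by blast
    have "m = t"
    proof (rule ccontr)
      assume "m \<noteq> t"
      then have "m < t" using m by simp
      obtain \<rho> where r: "\<rho> > 0" "\<And>t. t \<in> {-\<rho>..\<rho>} \<Longrightarrow> dist (\<phi> m x) (\<phi> t (\<phi> m x)) \<le> b * \<bar>t\<bar>"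
        using loc[of "\<phi> m x"] by blast
      define s where "s = min \<rho> (t - m)"
      have s: "0 < s" "s \<le> \<rho>" "m + s \<le> t" using r \<open>m < t\<close> by (auto simp: s_def)
      have "dist (\<phi> m x) (\<phi> (m + s) x) \<le> b * s"
        using r(2)[of s] s flow_add[of s m x] by (simp add: add.commute)
      then have "dist x (\<phi> (m + s) x) \<le> b * (m + s)"
        using m(1) dist_triangle[of x "\<phi> (m + s) x" "\<phi> m x"] by (simp add: algebra_simps)
      then have "m + s \<in> ?S" using m(1) s by auto
      then show False using m(2) s by force
    qed
    then show ?thesis using m by simp
  qed
  have "dist x (\<phi> t x) \<le> b * \<bar>t\<bar>" for x t
  proof (cases "0 \<le> t")
    case False
    then show ?thesis
      using pos[of "-t" "\<phi> t x"] by (simp add: dist_commute)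
  qed (use pos in auto)
  then show thesis using that[of b] ab by force
qed

text \<open>
  By transitivity, the images of a relatively compact open set \<open>W\<close> under the flow are dense. As the
  flow is continuous, the images of a countable dense subset of \<open>W\<close> at rational times are dense, too.
\<close>
lemma countable_dense:
  obtains D :: "'a set" where "countable D" "\<And>x e. 0 < e \<Longrightarrow> \<exists>d\<in>D. dist d x < e"
proof -
  obtain b where b: "0 < b" "\<And>x t. dist x (\<phi> t x) \<le> b * \<bar>t\<bar>"
    by (rule speed_bound) blast
  fix x0 :: 'a
  obtain W C where W: "open W" "x0 \<in> W" "compact C" "W \<subseteq> C"
    by (rule locally_compact)
  have "\<exists>F. finite F \<and> C \<subseteq> (\<Union>x\<in>F. ball x (1 / real (Suc n)))" for n
    using \<open>compact C\<close> compact_eq_totally_bounded[of C]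
    by (metis of_nat_0_less_iff zero_less_Suc zero_less_divide_1_iff)
  then obtain F where F: "\<And>n. finite (F n)" "\<And>n. C \<subseteq> (\<Union>x\<in>F n. ball x (1 / real (Suc n)))"
    by metis
  let ?D = "(\<lambda>(q, d). \<phi> q d) ` (\<rat> \<times> (\<Union>n. F n))"
  have "countable ?D"
    using F(1) by (intro countable_image countable_SIGMA countable_rat countable_UN)
      (auto simp: countable_finite)
  moreover have "\<exists>d\<in>?D. dist d x < e" if e: "0 < e" for x e
  proof -
    have "ball x (e / 3) \<noteq> {}" using e by (auto intro: centre_in_ball[THEN iffD2])
    then obtain t where "\<phi> t ` W \<inter> ball x (e / 3) \<noteq> {}"
      using transitivity[of W "ball x (e / 3)" 1] W by auto
    then obtain w where w: "w \<in> W" "dist x (\<phi> t w) < e / 3"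
      by auto
    obtain q where q: "q \<in> \<rat>" "t < q" "q < t + e / (3 * b)"
      using Rats_dense_in_real[of t "t + e / (3 * b)"] e b(1) by auto
    have "dist (\<phi> t w) (\<phi> q w) \<le> b * (q - t)"
      using b(2)[of "\<phi> t w" "q - t"] flow_add[of "q - t" t w] q by simp
    also have "\<dots> < e / 3" using q b(1) by (simp add: field_simps)
    finally have 1: "dist (\<phi> t w) (\<phi> q w) < e / 3" .
    have "continuous_on UNIV (\<phi> q)" by (intro flow_cont_pair continuous_intros)
    then obtain \<delta> where d: "\<delta> > 0" "\<And>y. dist y w < \<delta> \<Longrightarrow> dist (\<phi> q y) (\<phi> q w) < e / 3"
      unfolding continuous_on_iff using e by (metis UNIV_I zero_less_divide_iff zero_less_numeral)
    obtain n where n: "1 / real (Suc n) < \<delta>"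
      using d(1) nat_approx_posE by metis
    obtain y where y: "y \<in> F n" "dist y w < 1 / real (Suc n)"
      using F(2)[of n] w(1) W(4) by auto
    have "dist (\<phi> q y) (\<phi> q w) < e / 3" using d(2) y n by force
    then have "dist (\<phi> q y) x < e"
      using 1 w(2) dist_triangle[of "\<phi> q y" x "\<phi> q w"] dist_triangle[of "\<phi> q w" x "\<phi> t w"]
      by (simp add: dist_commute)
    then show ?thesis using q y by (intro bexI[of _ "\<phi> q y"]) auto
  qed
  ultimately show thesis by (rule that)
qed

text \<open>
  Balls with centres in a countable dense set and radii \<open>1 / (n + 1)\<close>, as far as they are relatively
  compact, form a countable cover of the manifold; finite unions of them exhaust the measure.
\<close>
lemma measure_exhaustion:
  assumes \<mu>: "invariant_probability \<phi> \<mu>" and p: "p < 1"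
  obtains S C where "open S" "compact C" "S \<subseteq> C" "p < measure \<mu> S"
proof -
  have sets: "sets \<mu> = sets borel" using \<mu> by (simp add: invariant_probability_def)
  interpret prob_space \<mu> using \<mu> by (simp add: invariant_probability_def)
  obtain D :: "'a set" where D: "countable D" "\<And>x e. 0 < e \<Longrightarrow> \<exists>d\<in>D. dist d x < e"
    by (rule countable_dense) blast
  define B where "B = {V. (\<exists>d\<in>D. \<exists>n. V = ball d (1 / real (Suc n))) \<and> (\<exists>C. compact C \<and> V \<subseteq> C)}"
  have "B \<subseteq> (\<lambda>(d, n). ball d (1 / real (Suc n))) ` (D \<times> UNIV)"
    by (auto simp: B_def)
  then have cB: "countable B"
    using D(1) by (rule countable_subset[OF _ countable_image[OF countable_SIGMA]]) auto
  have cover: "\<exists>V\<in>B. x \<in> V" for x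
  proof -
    obtain W C where W: "open W" "x \<in> W" "compact C" "W \<subseteq> C"
      by (rule locally_compact)
    obtain r where r: "r > 0" "ball x r \<subseteq> W" using W open_contains_ball by blast
    obtain n where n: "1 / real (Suc n) < r / 2"
      using r(1) nat_approx_posE[of "r / 2"] by auto
    obtain d where d: "d \<in> D" "dist d x < 1 / real (Suc n)"
      using D(2)[of "1 / real (Suc n)" x] by auto
    have "ball d (1 / real (Suc n)) \<subseteq> ball x r"
    proof
      fix y assume "y \<in> ball d (1 / real (Suc n))"
      then show "y \<in> ball x r" using d n dist_triangle[of x y d] by (simp add: dist_commute)
    qed
    then show ?thesis using d r W unfolding B_def by (intro bexI[of _ "ball d (1 / real (Suc n))"]) auto
  qed
  from cover[of undefined] have "B \<noteq> {}" by auto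
  define V where "V = from_nat_into B"
  have V: "range V = B"
    unfolding V_def using \<open>B \<noteq> {}\<close> cB by (rule range_from_nat_into)
  have VB: "V n \<in> B" for n
    using rangeI[of V n] unfolding V .
  have Vn: "open (V n)" for n
    using VB[of n] by (force simp: B_def)
  have "\<exists>C. compact C \<and> V n \<subseteq> C" for n
    using VB[of n] by (simp add: B_def)
  then obtain C where C: "\<And>n. compact (C n)" "\<And>n. V n \<subseteq> C n" by metis
  let ?S = "\<lambda>n. \<Union>i\<le>n. V i"
  have "(\<lambda>n. measure \<mu> (?S n)) \<longlonglongrightarrow> measure \<mu> (\<Union>n. ?S n)"
  proof (rule finite_Lim_measure_incseq)
    show "range ?S \<subseteq> sets \<mu>" using Vn by (auto simp: sets intro!: borel_open)
    show "incseq ?S" by (intro monoI UN_mono) auto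
  qed
  moreover have "(\<Union>n. ?S n) = space \<mu>"
  proof -
    have "x \<in> (\<Union>n. ?S n)" for x
    proof -
      obtain n where "x \<in> V n" using cover[of x] unfolding V[symmetric] by blast
      then show ?thesis by blast
    qed
    then show ?thesis using sets_eq_imp_space_eq[OF sets] by auto
  qed
  ultimately have "(\<lambda>n. measure \<mu> (?S n)) \<longlonglongrightarrow> 1" by (simp add: prob_space)
  then have "eventually (\<lambda>n. p < measure \<mu> (?S n)) sequentially"
    using p by (rule order_tendstoD)
  then obtain n where n: "p < measure \<mu> (?S n)"
    by (auto simp: eventually_sequentially)
  show thesis
  proof (rule that[OF _ _ _ n])
    show "open (?S n)" using Vn by auto
    show "compact (\<Union>i\<le>n. C i)" using C by auto
    show "?S n \<subseteq> (\<Union>i\<le>n. C i)" using C(2) by blast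
  qed
qed

end

section \<open>Periodic points\<close>

context C1_flow
begin

lemma flow_int_mult_period:
  assumes "\<phi> T x = x"
  shows "\<phi> (of_int n * T) x = x"
proof -
  have nat: "\<phi> (real k * T) x = x" for k
  proof (induction k)
    case (Suc k)
    have "\<phi> (real (Suc k) * T) x = \<phi> T (\<phi> (real k * T) x)"
      unfolding flow_add[symmetric] by (simp add: algebra_simps)
    with Suc assms show ?case by simp
  qed (simp add: flow_0)
  show ?thesis
  proof (cases "0 \<le> n")
    case True
    then show ?thesis using nat[of "nat n"] by simp
  next
    case False
    then have "\<phi> (of_int n * T) x = \<phi> (- (real (nat (- n)) * T)) (\<phi> (real (nat (- n)) * T) x)"
      using nat[of "nat (- n)"] by simp
    then show ?thesis by simp
  qed
qed

lemma periodic_orbit_parameter: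
  assumes "0 < T" "\<phi> T x = x" "y \<in> range (\<lambda>t. \<phi> t x)"
  obtains s where "0 \<le> s" "s < T" "x = \<phi> s y"
proof -
  obtain w where w: "y = \<phi> w x" using assms(3) by auto
  define n where "n = \<lfloor>-w / T\<rfloor>"
  define s where "s = -w - of_int n * T"
  have "of_int n \<le> -w / T" "-w / T < of_int n + 1"
    unfolding n_def by linarith+
  then have "of_int n * T \<le> -w" "-w < (of_int n + 1) * T"
    using assms(1) by (simp_all only: pos_le_divide_eq pos_divide_less_eq)
  then have "0 \<le> s" "s < T"
    unfolding s_def by (simp_all add: algebra_simps)
  moreover have "\<phi> s y = \<phi> (of_int (- n) * T) x"
    unfolding w s_def flow_add[symmetric] by simp
  then have "x = \<phi> s y"
    using flow_int_mult_period[OF assms(2)] by metis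
  ultimately show thesis by (rule that)
qed

end

section \<open>Closing up orbit segments\<close>

context H_flow
begin

text \<open>
  The constants of the closing lemma depend on the centre of a ball; finitely many of the balls of
  radius \<open>\<epsilon> / 2\<close> cover a compact set, so that common constants exist there.
\<close>
lemma uniform_closing:
  assumes "compact C" "0 < \<epsilon>"
  obtains \<delta> Tm where "0 < \<delta>" "0 < Tm"
    "\<And>x y t. x \<in> C \<Longrightarrow> dist x y < \<epsilon> / 2 \<Longrightarrow> Tm \<le> t \<Longrightarrow> dist (\<phi> t y) y \<le> \<delta> \<Longrightarrow>
       \<exists>z. \<exists>\<tau>\<in>{t - \<epsilon>..t + \<epsilon>}. \<phi> \<tau> z = z \<and> (\<forall>s\<in>{0..t}. dist (\<phi> s z) (\<phi> s y) \<le> \<epsilon>)"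
proof -
  have "\<exists>\<delta> Tm. 0 < \<delta> \<and> 0 < Tm \<and> (\<forall>y\<in>ball c \<epsilon>. \<forall>t\<ge>Tm. dist (\<phi> t y) y \<le> \<delta> \<longrightarrow>
      (\<exists>z. \<exists>\<tau>\<in>{t - \<epsilon>..t + \<epsilon>}. \<phi> \<tau> z = z \<and> (\<forall>s\<in>{0..t}. dist (\<phi> s z) (\<phi> s y) \<le> \<epsilon>)))" for c
    using closing_lemma[OF assms(2), of c] by meson
  then obtain \<delta> Tm where cl: "\<And>c. 0 < \<delta> c" "\<And>c. 0 < Tm c"
    "\<And>c y t. y \<in> ball c \<epsilon> \<Longrightarrow> Tm c \<le> t \<Longrightarrow> dist (\<phi> t y) y \<le> \<delta> c \<Longrightarrow>
      (\<exists>z. \<exists>\<tau>\<in>{t - \<epsilon>..t + \<epsilon>}. \<phi> \<tau> z = z \<and> (\<forall>s\<in>{0..t}. dist (\<phi> s z) (\<phi> s y) \<le> \<epsilon>))"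
    by metis
  obtain F where F: "finite F" "C \<subseteq> (\<Union>c\<in>F. ball c (\<epsilon> / 2))"
    using assms compact_eq_totally_bounded[of C] half_gt_zero by blast
  define d where "d = Min (insert 1 (\<delta> ` F))"
  define M where "M = Max (insert 1 (Tm ` F))"
  have d: "0 < d" "\<And>c. c \<in> F \<Longrightarrow> d \<le> \<delta> c"
    using F(1) cl(1) by (auto simp: d_def)
  have M: "1 \<le> M" "\<And>c. c \<in> F \<Longrightarrow> Tm c \<le> M"
    using F(1) by (auto simp: M_def)
  show thesis
  proof (rule that[OF d(1)])
    show "0 < M" using M(1) by simp
    fix x y t
    assume h: "x \<in> C" "dist x y < \<epsilon> / 2" "M \<le> t" "dist (\<phi> t y) y \<le> d"
    then obtain c where c: "c \<in> F" "dist c x < \<epsilon> / 2" using F(2) by auto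
    have "y \<in> ball c \<epsilon>" using c h(2) dist_triangle[of c y x] by simp
    then show "\<exists>z. \<exists>\<tau>\<in>{t - \<epsilon>..t + \<epsilon>}. \<phi> \<tau> z = z \<and> (\<forall>s\<in>{0..t}. dist (\<phi> s z) (\<phi> s y) \<le> \<epsilon>)"
      using cl(3) order_trans[OF M(2)[OF c(1)] h(3)] order_trans[OF h(4) d(2)[OF c(1)]] by blast
  qed
qed

text \<open>
  From near every point of \<open>S\<close> one reaches \<open>U\<close>, and from \<open>U\<close> one gets near every point of \<open>S\<close>, in
  a time bounded uniformly over \<open>S\<close>. The initial point \<open>u\<close> is taken in \<open>S\<close> to keep it inside
  a fixed compact set, as finite exact shadowing requires.
\<close>
lemma uniform_transit:
  assumes "compact C" "open S" "S \<subseteq> C" "open U" "U \<noteq> {}" "0 < \<eta>"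
  obtains R where "0 \<le> R"
    "\<And>x. x \<in> S \<Longrightarrow> \<exists>u\<in>S. \<exists>t\<in>{0..R}. dist x u < \<eta> \<and> \<phi> t u \<in> U"
    "\<And>x. x \<in> S \<Longrightarrow> \<exists>v\<in>U. \<exists>t\<in>{0..R}. dist (\<phi> t v) x < \<eta>"
proof -
  define V where "V = (\<lambda>c. ball c (\<eta> / 2) \<inter> S)"
  have opV: "open (V c)" for c using assms(2) by (auto simp: V_def)
  \<comment> \<open>If \<open>V c\<close> is empty, nothing is required beyond \<open>t \<ge> 1\<close>.\<close>
  have "\<exists>t\<ge>1. V c \<noteq> {} \<longrightarrow> \<phi> t ` V c \<inter> U \<noteq> {}" "\<exists>t\<ge>1. V c \<noteq> {} \<longrightarrow> \<phi> t ` U \<inter> V c \<noteq> {}" for c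
    using transitivity[OF opV[of c] assms(4) _ assms(5), of 1]
      transitivity[OF assms(4) opV[of c] assms(5), of 1] by (metis order_refl zero_less_one)+
  then obtain t s where t: "\<And>c. 1 \<le> t c" "\<And>c. V c \<noteq> {} \<Longrightarrow> \<phi> (t c) ` V c \<inter> U \<noteq> {}"
    and s: "\<And>c. 1 \<le> s c" "\<And>c. V c \<noteq> {} \<Longrightarrow> \<phi> (s c) ` U \<inter> V c \<noteq> {}"
    by metis
  obtain F where F: "finite F" "C \<subseteq> (\<Union>c\<in>F. ball c (\<eta> / 2))"
    using assms(1,6) compact_eq_totally_bounded[of C] half_gt_zero by blast
  define R where "R = Max (insert 0 (t ` F \<union> s ` F))"
  have R: "0 \<le> R" "\<And>c. c \<in> F \<Longrightarrow> t c \<le> R" "\<And>c. c \<in> F \<Longrightarrow> s c \<le> R"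
    using F(1) by (auto simp: R_def intro: Max_ge)
  have near: "\<exists>c\<in>F. x \<in> V c" if "x \<in> S" for x
    using that F(2) assms(3) unfolding V_def by blast
  have close: "dist x y < \<eta>" if "x \<in> V c" "y \<in> V c" for x y c
    using that dist_triangle[of x y c] by (simp add: V_def dist_commute)
  show thesis
  proof (rule that[OF R(1)])
    fix x assume "x \<in> S"
    then obtain c where c: "c \<in> F" "x \<in> V c" using near by blast
    then obtain u v where uv: "u \<in> V c" "\<phi> (t c) u \<in> U" "v \<in> U" "\<phi> (s c) v \<in> V c"
      using t(2)[of c] s(2)[of c] by blast
    have ts: "t c \<in> {0..R}" "s c \<in> {0..R}"
      using c(1) t(1)[of c] s(1)[of c] R(2,3)[of c] by simp_all
    have "u \<in> S" using uv(1) by (simp add: V_def)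
    with uv ts close[OF c(2) uv(1)]
    show "\<exists>u\<in>S. \<exists>t\<in>{0..R}. dist x u < \<eta> \<and> \<phi> t u \<in> U" by blast
    show "\<exists>v\<in>U. \<exists>t\<in>{0..R}. dist (\<phi> t v) x < \<eta>"
      using uv ts close[OF uv(4) c(2)] by blast
  qed
qed

text \<open>
  An orbit segment of length \<open>T\<close> that starts and ends in \<open>S\<close> is shadowed by a periodic orbit of period
  \<open>T + O(1)\<close> that meets \<open>K\<close>. Shadowing is applied to three segments: the given one, one from near its
  end into a small ball \<open>U\<close> around an interior point of \<open>K\<close>, and one from \<open>U\<close> to near its start. The
  resulting orbit nearly returns, hence the closing lemma yields a periodic one.
\<close>
lemma periodic_shadowing:
  assumes "compact C" "open S" "S \<subseteq> C" "compact K" "interior K \<noteq> {}" "0 < \<epsilon>"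
  obtains R T0 where "0 \<le> R" "1 < T0"
    "\<And>T x. T0 \<le> T \<Longrightarrow> x \<in> S \<Longrightarrow> \<phi> T x \<in> S \<Longrightarrow>
       \<exists>z. \<exists>\<tau>\<in>{T - 1..T + R}. \<phi> \<tau> z = z \<and> range (\<lambda>t. \<phi> t z) \<inter> K \<noteq> {} \<and>
         (\<forall>s\<in>{0..T}. dist (\<phi> s z) (\<phi> s x) < \<epsilon>)"
proof -
  obtain p where "p \<in> interior K" using assms(5) by blast
  then obtain r where r: "0 < r" "ball p r \<subseteq> K"
    using mem_interior by blast
  define e where "e = min (\<epsilon> / 2) (min (r / 4) (1 / 2))"
  have e: "0 < e" "e \<le> \<epsilon> / 2" "e \<le> r / 4" "e \<le> 1 / 2"
    using assms(6) r(1) by (auto simp: e_def)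
  obtain d Tm where d: "0 < d" "0 < Tm"
    and closing: "\<And>x y t. x \<in> C \<Longrightarrow> dist x y < e / 2 \<Longrightarrow> Tm \<le> t \<Longrightarrow> dist (\<phi> t y) y \<le> d \<Longrightarrow>
       \<exists>z. \<exists>\<tau>\<in>{t - e..t + e}. \<phi> \<tau> z = z \<and> (\<forall>s\<in>{0..t}. dist (\<phi> s z) (\<phi> s y) \<le> e)"
    by (rule uniform_closing[OF assms(1) e(1)]) blast
  define \<delta> where "\<delta> = min (e / 4) (d / 4)"
  have \<delta>: "0 < \<delta>" "\<delta> \<le> e / 4" "\<delta> \<le> d / 4" using e d by (auto simp: \<delta>_def)
  have CK: "compact (C \<union> K)" using assms by auto
  obtain \<eta>0 where \<eta>0: "0 < \<eta>0"
    and shadow: "\<And>(x :: nat \<Rightarrow> 'a) t. (\<forall>i\<in>{1..3}. x i \<in> C \<union> K \<and> 0 \<le> t i) \<and>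
           (\<forall>i\<in>{1..<3}. dist (\<phi> (t i) (x i)) (x (i + 1)) < \<eta>0) \<Longrightarrow>
           \<exists>y. \<forall>i\<in>{1..3}. \<forall>s\<in>{0..t i}.
              dist (\<phi> (s + (\<Sum>j\<in>{1..<i}. t j)) y) (\<phi> s (x i)) < \<delta>"
    using finite_exact_shadowing[OF CK \<delta>(1), of 3] by fastforce
  define \<eta> where "\<eta> = min \<eta>0 (d / 4)"
  have \<eta>: "0 < \<eta>" "\<eta> \<le> \<eta>0" "\<eta> \<le> d / 4" using \<eta>0 d by (auto simp: \<eta>_def)
  define U where "U = ball p (min (e / 2) (\<eta> / 2))"
  have U: "open U" "U \<noteq> {}" "U \<subseteq> K"
    using \<eta> e r by (auto simp: U_def)
  obtain R where R: "0 \<le> R"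
    and out: "\<And>x. x \<in> S \<Longrightarrow> \<exists>u\<in>S. \<exists>t\<in>{0..R}. dist x u < \<eta> \<and> \<phi> t u \<in> U"
    and inward: "\<And>x. x \<in> S \<Longrightarrow> \<exists>v\<in>U. \<exists>t\<in>{0..R}. dist (\<phi> t v) x < \<eta>"
    by (rule uniform_transit[OF assms(1-3) U(1,2) \<eta>(1)]) blast
  show thesis
  proof (rule that[of "2 * R + 1" "max Tm 2"])
    fix T x assume T: "max Tm 2 \<le> T" and x: "x \<in> S" "\<phi> T x \<in> S"
    obtain u t where u: "u \<in> S" "0 \<le> t" "t \<le> R" "dist (\<phi> T x) u < \<eta>" "\<phi> t u \<in> U"
      using out[OF x(2)] by auto
    obtain v s where v: "v \<in> U" "0 \<le> s" "s \<le> R" "dist (\<phi> s v) x < \<eta>"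
      using inward[OF x(1)] by auto
    have uv: "dist (\<phi> t u) v < \<eta>"
      using u(5) v(1) dist_triangle[of "\<phi> t u" v p] by (simp add: U_def dist_commute)
    \<comment> \<open>The three segments are numbered from \<open>1\<close>; their starting points are \<open>X\<close>, their lengths \<open>Y\<close>.\<close>
    define X where "X = (\<lambda>i::nat. if i = 1 then x else if i = 2 then u else v)"
    define Y where "Y = (\<lambda>i::nat. if i = 1 then T else if i = 2 then t else s)"
    have I: "{1..3} = {1, 2, 3::nat}" "{1..<3} = {1, 2::nat}" "{1..<2} = {1::nat}" by auto
    have "(\<forall>i\<in>{1..3}. X i \<in> C \<union> K \<and> 0 \<le> Y i) \<and>
        (\<forall>i\<in>{1..<3}. dist (\<phi> (Y i) (X i)) (X (i + 1)) < \<eta>0)"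
      using x u v uv T assms(3) U(3) \<eta>(2) unfolding I by (auto simp: X_def Y_def)
    from shadow[OF this] obtain y where y: "\<forall>i\<in>{1..3}. \<forall>r\<in>{0..Y i}.
        dist (\<phi> (r + (\<Sum>j\<in>{1..<i}. Y j)) y) (\<phi> r (X i)) < \<delta>"
      by blast
    have y1: "dist (\<phi> r y) (\<phi> r x) < \<delta>" if "r \<in> {0..T}" for r
      using bspec[OF y, of 1] that by (simp add: X_def Y_def)
    have y3: "dist (\<phi> (r + (T + t)) y) (\<phi> r v) < \<delta>" if "r \<in> {0..s}" for r
      using bspec[OF y, of 3, unfolded I] that by (simp add: X_def Y_def)
    define T' where "T' = T + t + s"
    have xy: "dist x y < \<delta>" using y1[of 0] T by (simp add: flow_0 dist_commute)
    have "dist (\<phi> T' y) (\<phi> s v) < \<delta>"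
      using y3[of s] v(2) by (simp add: T'_def algebra_simps)
    then have "dist (\<phi> T' y) y \<le> d"
      using xy v(4) d(1) \<delta>(3) \<eta>(3) dist_triangle[of "\<phi> T' y" y x] dist_triangle[of "\<phi> T' y" x "\<phi> s v"]
      by linarith
    moreover have "dist x y < e / 2" "Tm \<le> T'" using xy \<delta>(2) e(1) T u(2) v(2) unfolding T'_def
      by linarith+
    ultimately obtain z \<tau> where z: "\<tau> \<in> {T' - e..T' + e}" "\<phi> \<tau> z = z"
      "\<And>s. s \<in> {0..T'} \<Longrightarrow> dist (\<phi> s z) (\<phi> s y) \<le> e"
      using closing[of x y T'] x(1) assms(3) by blast
    have "\<tau> \<in> {T - 1..T + (2 * R + 1)}"
      using z(1) e u v by (auto simp: T'_def)
    \<comment> \<open>At time \<open>T + t\<close> the second segment has ended in \<open>U\<close>, so the periodic orbit is then inside \<open>K\<close>.\<close>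
    moreover have "\<phi> (T + t) z \<in> ball p r"
    proof -
      have "dist (\<phi> (T + t) z) (\<phi> (T + t) y) \<le> e"
        using z(3)[of "T + t"] u v T by (simp add: T'_def)
      moreover have "dist (\<phi> (T + t) y) v < \<delta>"
        using y3[of 0] v(2) by (simp add: flow_0)
      moreover have "dist p v < e / 2" using v(1) by (simp add: U_def)
      ultimately show ?thesis
        using \<delta>(2) e dist_triangle[of p "\<phi> (T + t) z" "\<phi> (T + t) y"]
          dist_triangle[of p "\<phi> (T + t) y" v] r(1)
        by (simp add: dist_commute)
    qed
    then have "range (\<lambda>t. \<phi> t z) \<inter> K \<noteq> {}" using r(2) by blast
    moreover have "dist (\<phi> r z) (\<phi> r x) < \<epsilon>" if "r \<in> {0..T}" for r
      using z(3)[of r] y1[OF that] that u(2) v(2) \<delta>(2) e(1,2)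
        dist_triangle[of "\<phi> r z" "\<phi> r x" "\<phi> r y"] by (simp add: T'_def)
    ultimately show "\<exists>z. \<exists>\<tau>\<in>{T - 1..T + (2 * R + 1)}. \<phi> \<tau> z = z \<and>
        range (\<lambda>t. \<phi> t z) \<inter> K \<noteq> {} \<and> (\<forall>s\<in>{0..T}. dist (\<phi> s z) (\<phi> s x) < \<epsilon>)"
      using z(2) by blast
  qed (use R in auto)
qed

end

section \<open>Separated sets and periodic orbits\<close>

text \<open>
  \<open>E\<close> is \<open>(T, \<epsilon>)\<close>-separated: any two distinct points of \<open>E\<close> are at distance at least \<open>\<epsilon>\<close> at some time
  in \<open>[0, T]\<close>.
\<close>
definition separated :: "(real \<Rightarrow> 'a \<Rightarrow> 'a::metric_space) \<Rightarrow> real \<Rightarrow> real \<Rightarrow> 'a set \<Rightarrow> bool" where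
  "separated \<phi> T \<epsilon> E \<longleftrightarrow> (\<forall>x\<in>E. \<forall>y\<in>E. x \<noteq> y \<longrightarrow> y \<notin> dynamical_ball \<phi> x \<epsilon> T)"

text \<open>
  If the cardinalities of finite separated subsets of \<open>Q\<close> are bounded, then one of maximal cardinality
  exists, and its dynamical balls cover \<open>Q\<close>.
\<close>
lemma separated_maximal:
  assumes "0 < \<epsilon>"
    and "\<And>E. finite E \<Longrightarrow> E \<subseteq> Q \<Longrightarrow> separated \<phi> T \<epsilon> E \<Longrightarrow> card E \<le> n"
  obtains E where "finite E" "E \<subseteq> Q" "card E \<le> n" "Q \<subseteq> (\<Union>x\<in>E. dynamical_ball \<phi> x \<epsilon> T)"
proof -
  let ?P = "\<lambda>E. finite E \<and> E \<subseteq> Q \<and> separated \<phi> T \<epsilon> E"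
  have "?P {}" by (simp add: separated_def)
  moreover have "\<forall>E. ?P E \<longrightarrow> card E < Suc n" using assms(2) by (simp add: less_Suc_eq_le)
  ultimately obtain E where E: "?P E" "\<And>F. ?P F \<Longrightarrow> card F \<le> card E"
    using ex_has_greatest_nat[of ?P "{}" card "Suc n"] by blast
  have "Q \<subseteq> (\<Union>x\<in>E. dynamical_ball \<phi> x \<epsilon> T)"
  proof (rule ccontr)
    assume "\<not> ?thesis"
    then obtain q where q: "q \<in> Q" "\<And>x. x \<in> E \<Longrightarrow> q \<notin> dynamical_ball \<phi> x \<epsilon> T" by blast
    have "q \<notin> E" using q(2)[of q] assms(1) by (auto simp: dynamical_ball_def)
    moreover have "separated \<phi> T \<epsilon> (insert q E)"
      using E(1) q(2) by (auto simp: separated_def dynamical_ball_def dist_commute)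
    ultimately show False
      using E(1) E(2)[of "insert q E"] q(1) by simp
  qed
  then show thesis using that E(1) assms(2) by blast
qed

context H_flow
begin

text \<open>
  A point \<open>x\<close> of a separated set is encoded by the periodic orbit \<open>\<gamma> x\<close> of period \<open>\<tau> x\<close> that shadows
  its orbit segment, and by the index, on a grid of mesh \<open>1 / c\<close>, of the time \<open>s x\<close> that leads from a base
  point of this orbit to the shadowing point \<open>z x\<close>. The code determines \<open>x\<close>: for two points with the
  same code the shadowing points differ by a time less than \<open>1 / c\<close>, so their orbits stay
  \<open>\<epsilon> / 3\<close>-close and the original segments \<open>\<epsilon>\<close>-close.
\<close>
lemma card_separated_le:
  assumes "compact C" "open S" "S \<subseteq> C" "compact K" "interior K \<noteq> {}" "0 < \<epsilon>"
  obtains R T0 c where "0 \<le> R" "0 < c" "1 < T0"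
    "\<And>T E. T0 \<le> T \<Longrightarrow> finite E \<Longrightarrow> E \<subseteq> S \<inter> \<phi> T -` S \<Longrightarrow> separated \<phi> T \<epsilon> E \<Longrightarrow>
       finite (periodic_orbits_meeting \<phi> K (T - 1) (T + R)) \<Longrightarrow>
       card E \<le> card (periodic_orbits_meeting \<phi> K (T - 1) (T + R)) * Suc (nat \<lfloor>c * (T + R)\<rfloor>)"
proof -
  have "0 < \<epsilon> / 3" using assms(6) by simp
  from periodic_shadowing[OF assms(1-5) this] obtain R T0 where R: "0 \<le> R" "1 < T0"
    and sh: "\<And>T x. T0 \<le> T \<Longrightarrow> x \<in> S \<Longrightarrow> \<phi> T x \<in> S \<Longrightarrow>
       \<exists>z. \<exists>\<tau>\<in>{T - 1..T + R}. \<phi> \<tau> z = z \<and> range (\<lambda>t. \<phi> t z) \<inter> K \<noteq> {} \<and>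
         (\<forall>s\<in>{0..T}. dist (\<phi> s z) (\<phi> s x) < \<epsilon> / 3)"
    by metis
  obtain b where b: "0 < b" "\<And>x t. dist x (\<phi> t x) \<le> b * \<bar>t\<bar>"
    by (rule speed_bound) blast
  \<comment> \<open>During a time less than \<open>1 / c\<close> every point moves by less than \<open>\<epsilon> / 3\<close>.\<close>
  define c where "c = 3 * b / \<epsilon>"
  have c: "0 < c" using b assms(6) by (simp add: c_def)
  show thesis
  proof (rule that[OF R(1) c R(2)])
    fix T E
    let ?P = "periodic_orbits_meeting \<phi> K (T - 1) (T + R)"
    assume T: "T0 \<le> T" and E: "finite E" "E \<subseteq> S \<inter> \<phi> T -` S" "separated \<phi> T \<epsilon> E" and fin: "finite ?P"
    have "\<forall>x\<in>E. \<exists>z \<tau>. \<tau> \<in> {T - 1..T + R} \<and> \<phi> \<tau> z = z \<and> range (\<lambda>t. \<phi> t z) \<inter> K \<noteq> {} \<and>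
         (\<forall>s\<in>{0..T}. dist (\<phi> s z) (\<phi> s x) < \<epsilon> / 3)"
    proof
      fix x assume "x \<in> E"
      then have "x \<in> S" "\<phi> T x \<in> S" using E(2) by auto
      from sh[OF T this] show "\<exists>z \<tau>. \<tau> \<in> {T - 1..T + R} \<and> \<phi> \<tau> z = z \<and>
          range (\<lambda>t. \<phi> t z) \<inter> K \<noteq> {} \<and> (\<forall>s\<in>{0..T}. dist (\<phi> s z) (\<phi> s x) < \<epsilon> / 3)"
        by blast
    qed
    then obtain z \<tau> where z: "\<And>x. x \<in> E \<Longrightarrow> \<tau> x \<in> {T - 1..T + R}" "\<And>x. x \<in> E \<Longrightarrow> \<phi> (\<tau> x) (z x) = z x"
      "\<And>x. x \<in> E \<Longrightarrow> range (\<lambda>t. \<phi> t (z x)) \<inter> K \<noteq> {}"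
      "\<And>x s. x \<in> E \<Longrightarrow> s \<in> {0..T} \<Longrightarrow> dist (\<phi> s (z x)) (\<phi> s x) < \<epsilon> / 3"
      by metis
    define \<gamma> where "\<gamma> = (\<lambda>x. range (\<lambda>t. \<phi> t (z x)))"
    \<comment> \<open>The base point depends only on the orbit as a set, not on \<open>x\<close>.\<close>
    define base where "base = (\<lambda>g::'a set. SOME p. p \<in> g)"
    have pos: "0 < \<tau> x" if "x \<in> E" for x using z(1)[OF that] T R(2) by auto
    have base: "base (\<gamma> x) \<in> \<gamma> x" for x
      unfolding base_def by (rule someI[of _ "\<phi> 0 (z x)"]) (auto simp: \<gamma>_def)
    have "\<exists>s. 0 \<le> s \<and> s < \<tau> x \<and> z x = \<phi> s (base (\<gamma> x))" if "x \<in> E" for x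
      using periodic_orbit_parameter[OF pos[OF that] z(2)[OF that]] base[of x]
      unfolding \<gamma>_def by metis
    then obtain s where s: "\<And>x. x \<in> E \<Longrightarrow> 0 \<le> s x" "\<And>x. x \<in> E \<Longrightarrow> s x < \<tau> x"
      "\<And>x. x \<in> E \<Longrightarrow> z x = \<phi> (s x) (base (\<gamma> x))"
      by metis
    define f where "f = (\<lambda>x. ((\<gamma> x, \<tau> x), nat \<lfloor>c * s x\<rfloor>))"
    have "inj_on f E"
    proof (rule inj_onI, rule ccontr)
      fix x y assume xy: "x \<in> E" "y \<in> E" "f x = f y" "x \<noteq> y"
      then have g: "\<gamma> x = \<gamma> y" and "nat \<lfloor>c * s x\<rfloor> = nat \<lfloor>c * s y\<rfloor>" by (auto simp: f_def)
      moreover have "0 \<le> c * s x" "0 \<le> c * s y" using c s(1) xy by auto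
      ultimately have "\<lfloor>c * s x\<rfloor> = \<lfloor>c * s y\<rfloor>" by (metis eq_nat_nat_iff zero_le_floor)
      then have "\<bar>c * s y - c * s x\<bar> < 1" by linarith
      then have "c * \<bar>s y - s x\<bar> < 1"
        using c by (metis abs_mult abs_of_pos right_diff_distrib)
      then have st: "b * \<bar>s y - s x\<bar> < \<epsilon> / 3"
        using assms(6) by (simp add: c_def field_simps)
      have zy: "z y = \<phi> (s y - s x) (z x)"
        using s(3)[OF xy(1)] s(3)[OF xy(2)] g by (simp add: flow_add[symmetric])
      have "dist (\<phi> r x) (\<phi> r y) < \<epsilon>" if r: "r \<in> {0..T}" for r
      proof -
        have "\<phi> r (z y) = \<phi> (s y - s x) (\<phi> r (z x))"
          unfolding zy flow_add[symmetric] by (simp add: add.commute)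
        then have "dist (\<phi> r (z x)) (\<phi> r (z y)) < \<epsilon> / 3"
          using b(2)[of "\<phi> r (z x)" "s y - s x"] st by simp
        then show ?thesis
          using z(4)[OF xy(1) r] z(4)[OF xy(2) r] dist_triangle[of "\<phi> r x" "\<phi> r y" "\<phi> r (z x)"]
            dist_triangle[of "\<phi> r (z x)" "\<phi> r y" "\<phi> r (z y)"] by (simp add: dist_commute)
      qed
      then have "y \<in> dynamical_ball \<phi> x \<epsilon> T" by (simp add: dynamical_ball_def)
      then show False using E(3) xy by (auto simp: separated_def)
    qed
    moreover have "f ` E \<subseteq> ?P \<times> {..nat \<lfloor>c * (T + R)\<rfloor>}"
    proof
      fix w assume "w \<in> f ` E"
      then obtain x where x: "x \<in> E" "w = f x" by auto
      have "(\<gamma> x, \<tau> x) \<in> ?P"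
        using z(1-3)[OF x(1)] pos[OF x(1)]
        unfolding periodic_orbits_meeting_def periodic_orbits_def \<gamma>_def by auto
      moreover have "c * s x \<le> c * (T + R)"
        using s(2)[OF x(1)] z(1)[OF x(1)] c by (intro mult_left_mono) auto
      ultimately show "w \<in> ?P \<times> {..nat \<lfloor>c * (T + R)\<rfloor>}"
        unfolding x(2) f_def by (auto intro!: nat_mono floor_mono)
    qed
    ultimately have "card E \<le> card (?P \<times> {..nat \<lfloor>c * (T + R)\<rfloor>})"
      using fin by (intro card_inj_on_le) auto
    then show "card E \<le> card ?P * Suc (nat \<lfloor>c * (T + R)\<rfloor>)"
      by (simp add: card_cartesian_product)
  qed
qed

text \<open>
  With \<open>\<mu> S > 3/4\<close>, invariance gives measure at least \<open>1/2\<close> to the set of points that are in \<open>S\<close> both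
  at time \<open>0\<close> and at time \<open>T\<close>.
\<close>
lemma min_spanning_le:
  assumes \<mu>: "invariant_probability \<phi> \<mu>" and "compact K" "interior K \<noteq> {}" "0 < \<epsilon>"
  obtains R T0 c where "0 \<le> R" "0 < c" "1 < T0"
    "\<And>T. T0 \<le> T \<Longrightarrow> finite (periodic_orbits_meeting \<phi> K (T - 1) (T + R)) \<Longrightarrow>
       min_spanning \<phi> T \<epsilon> (1 / 2) \<mu> \<le>
         enat (card (periodic_orbits_meeting \<phi> K (T - 1) (T + R)) * Suc (nat \<lfloor>c * (T + R)\<rfloor>))"
proof -
  have sets: "sets \<mu> = sets borel" using \<mu> by (simp add: invariant_probability_def)
  interpret prob_space \<mu> using \<mu> by (simp add: invariant_probability_def)
  obtain S C where S: "open S" "compact C" "S \<subseteq> C" "3 / 4 < measure \<mu> S"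
    by (rule measure_exhaustion[OF \<mu>, of "3 / 4"]) auto
  from card_separated_le[OF S(2,1,3) assms(2-4)]
  obtain R T0 c where R: "0 \<le> R" "0 < c" "1 < T0"
    and card: "\<And>T E. T0 \<le> T \<Longrightarrow> finite E \<Longrightarrow> E \<subseteq> S \<inter> \<phi> T -` S \<Longrightarrow> separated \<phi> T \<epsilon> E \<Longrightarrow>
       finite (periodic_orbits_meeting \<phi> K (T - 1) (T + R)) \<Longrightarrow>
       card E \<le> card (periodic_orbits_meeting \<phi> K (T - 1) (T + R)) * Suc (nat \<lfloor>c * (T + R)\<rfloor>)"
    by metis
  show thesis
  proof (rule that[OF R])
    fix T assume T: "T0 \<le> T" and fin: "finite (periodic_orbits_meeting \<phi> K (T - 1) (T + R))"
    let ?Q = "S \<inter> \<phi> T -` S"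
    obtain E where E: "finite E" "E \<subseteq> ?Q" 
      "card E \<le> card (periodic_orbits_meeting \<phi> K (T - 1) (T + R)) * Suc (nat \<lfloor>c * (T + R)\<rfloor>)"
      "?Q \<subseteq> (\<Union>x\<in>E. dynamical_ball \<phi> x \<epsilon> T)"
      by (rule separated_maximal[OF assms(4) card[OF T _ _ _ fin]])
    have "continuous_on UNIV (\<phi> T)" by (intro flow_cont_pair continuous_intros)
    then have op: "open (\<phi> T -` S)" using S(1) by (simp add: open_vimage)
    have "1 / 2 \<le> measure \<mu> ?Q"
    proof -
      have "measure \<mu> (S \<union> \<phi> T -` S) = measure \<mu> S + measure \<mu> (\<phi> T -` S) - measure \<mu> ?Q"
        using S(1) op by (intro measure_Un3) (auto simp: fmeasurable_eq_sets sets)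
      then show ?thesis
        using S(4) invariant_probability_measure[OF \<mu> S(1), of T] prob_le_1[of "S \<union> \<phi> T -` S"]
        by simp
    qed
    also have "\<dots> \<le> measure \<mu> (\<Union>x\<in>E. dynamical_ball \<phi> x \<epsilon> T)"
      using E(4) by (intro finite_measure_mono) (auto simp: sets intro!: borel_open open_dynamical_ball)
    finally have "spanning \<phi> T \<epsilon> (1 / 2) \<mu> E" using E(1) by (simp add: spanning_def)
    then have "min_spanning \<phi> T \<epsilon> (1 / 2) \<mu> \<le> enat (card E)"
      unfolding min_spanning_def by (intro INF_lower) simp
    also have "\<dots> \<le> enat (card (periodic_orbits_meeting \<phi> K (T - 1) (T + R)) * Suc (nat \<lfloor>c * (T + R)\<rfloor>))"
      using E(3) by simp
    finally show "min_spanning \<phi> T \<epsilon> (1 / 2) \<mu> \<le>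
         enat (card (periodic_orbits_meeting \<phi> K (T - 1) (T + R)) * Suc (nat \<lfloor>c * (T + R)\<rfloor>))" .
  qed
qed

end

section \<open>Exponential growth rates\<close>

lemma log_enat_quotient_less_imp:
  assumes "log_enat m / ereal L < ereal h" "0 < L"
  obtains k where "m = enat k" "real k \<le> exp (h * L)"
proof (cases m)
  case (enat k)
  have "real k \<le> exp (h * L)"
  proof (cases "k = 0")
    case False
    then have "ln (real k) / L < h"
      using assms enat by (simp add: log_enat_def)
    then have "ln (real k) < h * L"
      using assms(2) by (simp add: field_simps)
    then have "exp (ln (real k)) \<le> exp (h * L)" by simp
    then show ?thesis using False by simp
  qed simp
  with enat show thesis by (rule that)
next
  case infinity
  with assms show thesis by (simp add: log_enat_def)
qed

lemma log_enat_quotient_le: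
  assumes "m \<le> enat k" "real k \<le> X" "0 < T"
  shows "log_enat m / ereal T \<le> ereal (ln X / T)"
proof -
  obtain j where j: "m = enat j" "j \<le> k"
    using assms(1) by (cases m) auto
  show ?thesis
  proof (cases "j = 0")
    case True
    then show ?thesis using j(1) assms(3) by (simp add: log_enat_def)
  next
    case False
    then have "ln (real j) \<le> ln X"
      using j(2) assms(2) by (intro ln_mono) auto
    then show ?thesis
      using j(1) False assms(3) by (simp add: log_enat_def divide_right_mono)
  qed
qed

lemma periodic_orbits_meeting_cover:
  assumes "0 < \<sigma>" "0 \<le> R"
  shows "periodic_orbits_meeting \<phi> K T (T + R) \<subseteq>
    (\<Union>i\<le>nat \<lfloor>R / \<sigma>\<rfloor>. periodic_orbits_meeting \<phi> K (T + real i * \<sigma>) (T + real i * \<sigma> + \<sigma>))"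
proof
  fix w assume "w \<in> periodic_orbits_meeting \<phi> K T (T + R)"
  then obtain g \<tau> where w: "w = (g, \<tau>)" "(g, \<tau>) \<in> periodic_orbits \<phi>" "g \<inter> K \<noteq> {}"
    and \<tau>: "T \<le> \<tau>" "\<tau> \<le> T + R"
    by (auto simp: periodic_orbits_meeting_def)
  define i where "i = nat \<lfloor>(\<tau> - T) / \<sigma>\<rfloor>"
  have "0 \<le> (\<tau> - T) / \<sigma>" using \<tau>(1) assms(1) by simp
  then have "real i \<le> (\<tau> - T) / \<sigma>" "(\<tau> - T) / \<sigma> < real i + 1"
    unfolding i_def by linarith+
  then have "real i * \<sigma> \<le> \<tau> - T" "\<tau> - T < (real i + 1) * \<sigma>"
    using assms(1) by (simp_all only: pos_le_divide_eq pos_divide_less_eq)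
  then have "w \<in> periodic_orbits_meeting \<phi> K (T + real i * \<sigma>) (T + real i * \<sigma> + \<sigma>)"
    using w by (simp add: periodic_orbits_meeting_def algebra_simps)
  moreover have "i \<le> nat \<lfloor>R / \<sigma>\<rfloor>"
    unfolding i_def using \<tau> assms by (intro nat_mono floor_mono divide_right_mono) auto
  ultimately show "w \<in> (\<Union>i\<le>nat \<lfloor>R / \<sigma>\<rfloor>.
      periodic_orbits_meeting \<phi> K (T + real i * \<sigma>) (T + real i * \<sigma> + \<sigma>))"
    by blast
qed

text \<open>
  The growth rate of periodic orbits with periods in windows of length \<open>\<sigma>\<close> controls windows of any
  length \<open>R\<close>. The bound \<open>h\<close> may be negative.
\<close>
lemma card_periodic_orbits_meeting_bound:
  assumes "gurevic_entropy \<phi> K \<sigma> < ereal h" "0 < \<sigma>" "0 \<le> R"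
  obtains D T0 where "0 < D"
    "\<And>T. T0 \<le> T \<Longrightarrow> finite (periodic_orbits_meeting \<phi> K T (T + R)) \<and>
       real (card (periodic_orbits_meeting \<phi> K T (T + R))) \<le> D * exp (h * T)"
proof -
  let ?P = "\<lambda>L. periodic_orbits_meeting \<phi> K L (L + \<sigma>)"
  have "eventually (\<lambda>L. log_enat (ecard (?P L)) / ereal L < ereal h) at_top"
    using assms(1) unfolding gurevic_entropy_def by (rule Limsup_lessD)
  then obtain L0 where L0: "\<And>L. L0 \<le> L \<Longrightarrow> log_enat (ecard (?P L)) / ereal L < ereal h"
    by (auto simp: eventually_at_top_linorder)
  have P: "finite (?P L) \<and> real (card (?P L)) \<le> exp (h * L)" if "max L0 1 \<le> L" for L
  proof -
    have "L0 \<le> L" "0 < L" using that by auto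
    then obtain k where "ecard (?P L) = enat k" "real k \<le> exp (h * L)"
      using log_enat_quotient_less_imp[OF L0] by metis
    then show ?thesis by (auto simp: ecard_def split: if_splits)
  qed
  define n where "n = nat \<lfloor>R / \<sigma>\<rfloor>"
  define D where "D = (\<Sum>i\<le>n. exp (h * (real i * \<sigma>)))"
  have "0 < D" unfolding D_def by (intro sum_pos) auto
  moreover have "finite (periodic_orbits_meeting \<phi> K T (T + R)) \<and>
       real (card (periodic_orbits_meeting \<phi> K T (T + R))) \<le> D * exp (h * T)"
    if T: "max L0 1 \<le> T" for T
  proof -
    have P': "finite (?P (T + real i * \<sigma>)) \<and>
        real (card (?P (T + real i * \<sigma>))) \<le> exp (h * (T + real i * \<sigma>))" for i
      using T assms(2) by (intro P) (simp add: add_increasing2)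
    have cov: "periodic_orbits_meeting \<phi> K T (T + R) \<subseteq> (\<Union>i\<le>n. ?P (T + real i * \<sigma>))"
      using periodic_orbits_meeting_cover[OF assms(2,3)] by (simp add: n_def)
    have fin: "finite (\<Union>i\<le>n. ?P (T + real i * \<sigma>))" using P' by auto
    have "real (card (periodic_orbits_meeting \<phi> K T (T + R)))
        \<le> real (card (\<Union>i\<le>n. ?P (T + real i * \<sigma>)))"
      using card_mono[OF fin cov] by simp
    also have "\<dots> \<le> real (\<Sum>i\<le>n. card (?P (T + real i * \<sigma>)))"
      by (intro of_nat_mono card_UN_le) auto
    also have "\<dots> \<le> (\<Sum>i\<le>n. exp (h * (T + real i * \<sigma>)))"
      using P' by (simp add: sum_mono)
    also have "\<dots> = D * exp (h * T)"
      by (simp add: D_def sum_distrib_left distrib_left exp_add mult.commute)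
    finally show ?thesis using finite_subset[OF cov fin] by blast
  qed
  ultimately show thesis by (rule that)
qed

lemma linear_times_exp_rate:
  fixes D c R h :: real
  assumes "0 < D" "0 < c"
  shows "((\<lambda>T. ln (D * exp (h * (T - 1)) * (c * (T + R) + 1)) / T) \<longlongrightarrow> h) at_top"
proof -
  have "((\<lambda>T. (ln D + h * (T - 1) + ln (c * (T + R) + 1)) / T) \<longlongrightarrow> h) at_top"
    using assms by real_asymp
  moreover have "eventually (\<lambda>T. 0 < c * (T + R) + 1) at_top"
    using assms by real_asymp
  then have "eventually (\<lambda>T. (ln D + h * (T - 1) + ln (c * (T + R) + 1)) / T =
      ln (D * exp (h * (T - 1)) * (c * (T + R) + 1)) / T) at_top"
    by eventually_elim (use assms in \<open>simp add: ln_mult\<close>)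
  ultimately show ?thesis by (rule Lim_transform_eventually)
qed

theorem theorem4p3:
  fixes A :: "('a::metric_space, 'e::euclidean_space) chart set"
    and G :: "('a, 'e) local_metric"
    and \<phi> :: "real \<Rightarrow> 'a \<Rightarrow> 'a"
    and \<mu> :: "'a measure"
    and K :: "'a set"
    and \<sigma> :: real
  assumes "H_flow A G \<phi>"
    and "invariant_probability \<phi> \<mu>"
    and "compact K" and "interior K \<noteq> {}" and "0 < \<sigma>"
  shows "katok_entropy \<phi> \<mu> \<le> gurevic_entropy \<phi> K \<sigma>"
proof -
  interpret H_flow A G \<phi> by fact
  let ?M = "\<lambda>\<epsilon> T. log_enat (min_spanning \<phi> T \<epsilon> (1 / 2) \<mu>) / ereal T"
  have bound: "Limsup at_top (?M \<epsilon>) \<le> gurevic_entropy \<phi> K \<sigma>" if \<epsilon>: "0 < \<epsilon>" for \<epsilon>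
  proof (rule dense_ge)
    fix h' assume h': "gurevic_entropy \<phi> K \<sigma> < h'"
    show "Limsup at_top (?M \<epsilon>) \<le> h'"
    proof (cases h')
      case (real h)
      obtain R T0 c where R: "0 \<le> R" "0 < c" "1 < T0"
        and span: "\<And>T. T0 \<le> T \<Longrightarrow> finite (periodic_orbits_meeting \<phi> K (T - 1) (T + R)) \<Longrightarrow>
          min_spanning \<phi> T \<epsilon> (1 / 2) \<mu> \<le>
            enat (card (periodic_orbits_meeting \<phi> K (T - 1) (T + R)) * Suc (nat \<lfloor>c * (T + R)\<rfloor>))"
        by (rule min_spanning_le[OF assms(2-4) \<epsilon>]) metis
      obtain D T1 where D: "0 < D"
        and count: "\<And>T. T1 \<le> T \<Longrightarrow> finite (periodic_orbits_meeting \<phi> K T (T + (R + 1))) \<and>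
          real (card (periodic_orbits_meeting \<phi> K T (T + (R + 1)))) \<le> D * exp (h * T)"
        using card_periodic_orbits_meeting_bound[of \<phi> K \<sigma> h "R + 1"] h' real assms(5) R(1)
        by (metis add_nonneg_nonneg zero_le_one)
      let ?X = "\<lambda>T. D * exp (h * (T - 1)) * (c * (T + R) + 1)"
      \<comment> \<open>The count is used with \<open>T - 1\<close> and \<open>R + 1\<close>, that is, on the window \<open>[T - 1, T + R]\<close>.\<close>
      have "eventually (\<lambda>T. ?M \<epsilon> T \<le> ereal (ln (?X T) / T)) at_top"
        using eventually_ge_at_top[of "max T0 (T1 + 1)"]
      proof eventually_elim
        case (elim T)
        let ?P = "periodic_orbits_meeting \<phi> K (T - 1) (T + R)"
        have P: "finite ?P" "real (card ?P) \<le> D * exp (h * (T - 1))"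
          using count[of "T - 1"] elim by (simp_all add: algebra_simps)
        have "0 \<le> c * (T + R)" using R elim by simp
        then have "real (Suc (nat \<lfloor>c * (T + R)\<rfloor>)) \<le> c * (T + R) + 1" by linarith
        then have "real (card ?P * Suc (nat \<lfloor>c * (T + R)\<rfloor>)) \<le> ?X T"
          unfolding of_nat_mult using P(2) D by (intro mult_mono) auto
        moreover have "min_spanning \<phi> T \<epsilon> (1 / 2) \<mu> \<le> enat (card ?P * Suc (nat \<lfloor>c * (T + R)\<rfloor>))"
          using span[OF _ P(1)] elim by simp
        ultimately show ?case
          using R(3) elim by (intro log_enat_quotient_le) auto
      qed
      then have "Limsup at_top (?M \<epsilon>) \<le> Limsup at_top (\<lambda>T. ereal (ln (?X T) / T))"
        by (rule Limsup_mono)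
      also have "\<dots> = ereal h"
        using linear_times_exp_rate[OF D R(2)] by (intro lim_imp_Limsup) auto
      finally show ?thesis by (simp add: real)
    qed (use h' in auto)
  qed
  have "katok_entropy \<phi> \<mu> \<le> (SUP \<epsilon>\<in>{0<..}. Limsup at_top (?M \<epsilon>))"
    unfolding katok_entropy_def by (intro INF_lower) auto
  also have "\<dots> \<le> gurevic_entropy \<phi> K \<sigma>"
    using bound by (intro SUP_least) auto
  finally show ?thesis .
qed

end
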